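(* Let $(X,d)$ be a compact length space equipped with a Borel probability measure $\nu$, let $f\in C(X)$, and let $Q_t$ ($t\ge0$) be the operators on $C(X)$ defined by $(Q_tf)(x)=\inf_{y\in X}\left[f(y)+\frac{d(x,y)^2}{2t}\right]$ for $t>0$ and $Q_0f=f$. Then: (i) For any $s,t\ge0$, $Q_tQ_sf=Q_{t+s}f$. (ii) For any $x\in X$ (and $t\ge 0$), $\inf f\le(Q_tf)(x)\le f(x)$. (iii) For any $t>0$, $Q_tf\in\mathrm{Lip}(X)$. (iv) For any $x\in X$, $(Q_tf)(x)$ is a nonincreasing function of $t$ that converges monotonically to $f(x)$ as $t\to0$. In particular, $\lim_{t\to0}Q_tf=f$ in $C(X)$. (v) For any $t\ge0$, $s>0$ and $x\in X$, $$\frac{|Q_{t+s}f(x)-Q_tf(x)|}{s}\le\frac{\|Q_tf\|_{\mathrm{Lip}}^2}{2}.$$ (vi) For any $x\in X$ and $t\ge0$, $$\liminf_{s\to0^+}\frac{(Q_{t+s}f)(x)-(Q_tf)(x)}{s}\ge-\frac{|\nabla^-Q_tf|(x)^2}{2}.$$ (vii) If $(X,d,\nu)$ satisfies a doubling condition and a local Poincaré inequality, then for every $t>0$ and for $\nu$-almost every $x\in X$, $$\lim_{s\to0^+}\frac{(Q_{t+s}f)(x)-(Q_tf)(x)}{s}=-\frac{|\nabla^-Q_tf|(x)^2}{2}.$$ (viii) If $(X,d)$ is a finite-dimensional space with Alexandrov curvature bounded below, then for any $t>0$ and any $x\in X$, $$\lim_{s\to0^+}\frac{(Q_{t+s}f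)(x)-(Q_tf)(x)}{s}=-\frac{|\nabla^-Q_tf|(x)^2}{2}.$$
   Context: $C(X)$ is the space of continuous real-valued functions on $X$ with the uniform norm; $\mathrm{Lip}(X)$ is the set of real-valued Lipschitz functions on $X$; $\|g\|_{\mathrm{Lip}}\in[0,\infty]$ is the best Lipschitz constant of $g$ (equal to $+\infty$ if $g$ is not Lipschitz). Write $a_+=\max(a,0)$. For $g\in C(X)$ and $x\in X$, the subgradient norm of $g$ at $x$ is $$|\nabla^- g|(x)=\limsup_{y\to x}\frac{[g(x)-g(y)]_+}{d(x,y)}\in[0,\infty].$$ Doubling condition: there is a constant $C<\infty$ such that $\nu(B_{2r}(x))\le C\,\nu(B_r(x))$ for all $x\in X$ and $r>0$, where $B_r(x)$ is the open ball. Local Poincaré inequality (weak Poincaré inequality of type $(1,1)$): there are constants $\Lambda\ge1$ and $P<\infty$ such that for every $\nu$-integrable Borel function $u:X\to\mathbb{R}$, every upper gradient $g$ of $u$, every $x\in X$ and $r>0$ with $\nu(B_r(x))>0$, $$\frac{1}{\nu(B_r(x))}\int_{B_r(x)}|u-u_{x,r}|\,d\nu\le P\,r\,\frac{1}{\nu(B_{\Lambda r}(x))}\int_{B_{\Lambda r}(x)}g\,d\nu,\qquad u_{x,r}=\frac{1}{\nu(B_r(x))}\int_{B_r(x)}u\,d\nu.$$ An upper gradient of $u$ is a Borel function $g:X\to[0,\infty]$ such that $|u(\gamma(0))-u(\gamma(\ell))|\le\int_0^{\ell}g(\gamma(s))\,ds$ for every rectifiable curve $\gamma:[0,\ell]\to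 X$ parametrized by arclength. In (viii), "finite-dimensional with Alexandrov curvature bounded below" means that $X$ has finite Hausdorff dimension and curvature $\ge k$ in the sense of Alexandrov (triangle comparison) for some $k\in\mathbb{R}$. *)

theory Defs
  imports "HOL-Probability.Probability_Measure"
begin

text \<open>
  A metric space is a type of class \<^class>\<open>metric_space\<close>; the space \<open>X\<close> of the theorem is
  \<open>UNIV :: 'a set\<close>. As \<open>X\<close> is compact, \<open>C(X)\<close> with the uniform norm is the type
  \<open>'a \<Rightarrow>\<^sub>C real\<close> of bounded continuous functions.
\<close>

subsection \<open>Curves and length spaces\<close>

definition curve_length :: "(real \<Rightarrow> 'a::metric_space) \<Rightarrow> real \<Rightarrow> real \<Rightarrow> ennreal" where
  "curve_length \<gamma> a b =
    (SUP (n, \<tau>) \<in> {(n :: nat, \<tau> :: nat \<Rightarrow> real). mono_on {..n} \<tau> \<and> \<tau> ` {..n} \<subseteq> {a..b}}.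
       \<Sum>i<n. ennreal (dist (\<gamma> (\<tau> i)) (\<gamma> (\<tau> (Suc i)))))"

text \<open>In \<^typ>\<open>ennreal\<close> the infimum over no curves is \<open>\<infinity>\<close>, so any two points are joined by a
  curve of finite length.\<close>

definition length_space :: "'a::metric_space set \<Rightarrow> bool" where
  "length_space X \<longleftrightarrow> (\<forall>x\<in>X. \<forall>y\<in>X.
     ennreal (dist x y) =
       (INF \<gamma> \<in> {\<gamma>. path \<gamma> \<and> path_image \<gamma> \<subseteq> X \<and> pathstart \<gamma> = x \<and> pathfinish \<gamma> = y}.
          curve_length \<gamma> 0 1))"

definition arclength_curve :: "(real \<Rightarrow> 'a::metric_space) \<Rightarrow> real \<Rightarrow> bool" where
  "arclength_curve \<gamma> l \<longleftrightarrow> 0 \<le> l \<and> continuous_on {0..l} \<gamma> \<and>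
     (\<forall>s t. 0 \<le> s \<longrightarrow> s \<le> t \<longrightarrow> t \<le> l \<longrightarrow> curve_length \<gamma> s t = ennreal (t - s))"


subsection \<open>Lipschitz constant and subgradient norm\<close>

definition lip_norm :: "('a::metric_space \<Rightarrow> real) \<Rightarrow> ennreal" where
  "lip_norm g = Inf (ennreal ` {L. L-lipschitz_on UNIV g})"

text \<open>At an isolated point the filter \<open>at x\<close> is trivial and the value is \<open>0\<close>.\<close>

definition subgrad_norm :: "('a::metric_space \<Rightarrow> real) \<Rightarrow> 'a \<Rightarrow> ennreal" where
  "subgrad_norm g x = Limsup (at x) (\<lambda>y. ennreal (max (g x - g y) 0 / dist x y))"


subsection \<open>The operators \<open>Q\<^sub>t\<close>\<close>

lemma hopf_lax_bcontfun:
  fixes f :: "'a::metric_space \<Rightarrow> real"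
  assumes f: "f \<in> bcontfun" and t: "t > 0"
  shows "(\<lambda>x. INF y. f y + (dist x y)\<^sup>2 / (2 * t)) \<in> bcontfun"
proof -
  define g where "g = (\<lambda>x. INF y. f y + (dist x y)\<^sup>2 / (2 * t))"
  from f obtain B where B: "\<bar>f x\<bar> \<le> B" for x
    by (auto simp: bcontfun_def bounded_iff)
  have fB: "- B \<le> f x" "f x \<le> B" for x
    using B[of x] by auto
  have lb: "- B \<le> f y + (dist x y)\<^sup>2 / (2 * t)" for x y
  proof -
    have "0 \<le> (dist x y)\<^sup>2 / (2 * t)" using t by simp
    then show ?thesis using fB(1)[of y] by linarith
  qed
  have bdd: "bdd_below (range (\<lambda>y. f y + (dist x y)\<^sup>2 / (2 * t)))" for x
    by (rule bdd_belowI2[where m = "- B"]) (rule lb)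
  have g_le: "g x \<le> f y + (dist x y)\<^sup>2 / (2 * t)" for x y
    unfolding g_def by (rule cINF_lower[OF bdd]) simp
  have g_ge: "- B \<le> g x" for x
    unfolding g_def by (rule cINF_greatest) (auto intro: lb)
  have g_leB: "g x \<le> B" for x
    using g_le[of x x] fB(2)[of x] by simp
  define R where "R = sqrt (2 * t * (2 * B + 1))"
  have est: "g x' \<le> g x + (2 * R * dist x x' + (dist x x')\<^sup>2) / (2 * t)" for x x'
  proof (rule field_le_epsilon)
    fix e :: real assume e: "0 < e"
    have "(INF y. f y + (dist x y)\<^sup>2 / (2 * t)) < g x + min e 1"
      using e by (simp add: g_def)
    then obtain y where y: "f y + (dist x y)\<^sup>2 / (2 * t) < g x + min e 1"
      using bdd by (subst (asm) cINF_less_iff) auto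
    have "(dist x y)\<^sup>2 / (2 * t) \<le> 2 * B + 1"
      using y g_leB[of x] fB(1)[of y] by linarith
    then have "(dist x y)\<^sup>2 \<le> 2 * t * (2 * B + 1)"
      using t by (simp add: field_simps)
    then have dR: "dist x y \<le> R"
      unfolding R_def by (rule real_le_rsqrt)
    have "dist x' y \<le> dist x x' + dist x y"
      by (metis dist_commute dist_triangle)
    then have "(dist x' y)\<^sup>2 \<le> (dist x x' + dist x y)\<^sup>2"
      by (simp add: power_mono)
    also have "\<dots> = (dist x y)\<^sup>2 + (2 * dist x y * dist x x' + (dist x x')\<^sup>2)"
      by (simp add: power2_eq_square algebra_simps)
    also have "\<dots> \<le> (dist x y)\<^sup>2 + (2 * R * dist x x' + (dist x x')\<^sup>2)"
      using dR by (simp add: mult_right_mono)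
    finally have "(dist x' y)\<^sup>2 / (2 * t)
        \<le> ((dist x y)\<^sup>2 + (2 * R * dist x x' + (dist x x')\<^sup>2)) / (2 * t)"
      using t by (simp add: divide_right_mono)
    then show "g x' \<le> g x + (2 * R * dist x x' + (dist x x')\<^sup>2) / (2 * t) + e"
      using g_le[of x' y] y by (simp add: add_divide_distrib)
  qed
  have "(g \<longlongrightarrow> g x) (at x)" for x
  proof -
    have "((\<lambda>x'. (2 * R * dist x x' + (dist x x')\<^sup>2) / (2 * t)) \<longlongrightarrow>
            (2 * R * dist x x + (dist x x)\<^sup>2) / (2 * t)) (at x)"
      using t by (intro tendsto_intros) auto
    then have lim: "((\<lambda>x'. (2 * R * dist x x' + (dist x x')\<^sup>2) / (2 * t)) \<longlongrightarrow> 0) (at x)"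
      by simp
    have "norm (g x' - g x) \<le> (2 * R * dist x x' + (dist x x')\<^sup>2) / (2 * t)" for x'
      using est[of x' x] est[of x x'] by (simp add: dist_commute abs_le_iff)
    then have "((\<lambda>x'. g x' - g x) \<longlongrightarrow> 0) (at x)"
      by (intro Lim_null_comparison[OF _ lim] always_eventually allI)
    then show ?thesis by (simp add: LIM_zero_iff)
  qed
  then have "continuous_on UNIV g"
    by (simp add: continuous_on_def)
  moreover have "bounded (range g)"
  proof (rule boundedI)
    fix z assume "z \<in> range g"
    then show "norm z \<le> B" using g_ge g_leB by (auto simp: abs_le_iff minus_le_iff)
  qed
  ultimately show ?thesis by (simp add: bcontfun_def g_def)
qed

context
  includes bcontfun.lifting
begin

lift_definition hopf_lax :: "real \<Rightarrow> ('a::metric_space \<Rightarrow>\<^sub>C real) \<Rightarrow> ('a \<Rightarrow>\<^sub>C real)"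
  is "\<lambda>t f x. if t > 0 then INF y. f y + (dist x y)\<^sup>2 / (2 * t) else f x"
  subgoal for t f by (cases "t > 0") (simp_all add: hopf_lax_bcontfun)
  done

end


subsection \<open>Doubling condition and local Poincare inequality\<close>

definition doubling :: "'a::metric_space measure \<Rightarrow> bool" where
  "doubling \<nu> \<longleftrightarrow> (\<exists>C<\<infinity>. \<forall>x. \<forall>r>0. emeasure \<nu> (ball x (2 * r)) \<le> C * emeasure \<nu> (ball x r))"

definition upper_gradient :: "('a::metric_space \<Rightarrow> real) \<Rightarrow> ('a \<Rightarrow> ennreal) \<Rightarrow> bool" where
  "upper_gradient u g \<longleftrightarrow> g \<in> borel_measurable borel \<and>
     (\<forall>\<gamma> l. arclength_curve \<gamma> l \<longrightarrow>
        ennreal \<bar>u (\<gamma> 0) - u (\<gamma> l)\<bar> \<le> (\<integral>\<^sup>+s\<in>{0..l}. g (\<gamma> s) \<partial>lborel))"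

definition ball_average :: "'a::metric_space measure \<Rightarrow> ('a \<Rightarrow> real) \<Rightarrow> 'a \<Rightarrow> real \<Rightarrow> real" where
  "ball_average \<nu> u x r = (LINT y:ball x r|\<nu>. u y) / measure \<nu> (ball x r)"

definition local_poincare :: "'a::metric_space measure \<Rightarrow> bool" where
  "local_poincare \<nu> \<longleftrightarrow>
     (\<exists>\<Lambda>\<ge>1. \<exists>P<\<infinity>. \<forall>u g. u \<in> borel_measurable borel \<longrightarrow> integrable \<nu> u \<longrightarrow> upper_gradient u g \<longrightarrow>
        (\<forall>x. \<forall>r>0. emeasure \<nu> (ball x r) > 0 \<longrightarrow>
           (\<integral>\<^sup>+y\<in>ball x r. ennreal \<bar>u y - ball_average \<nu> u x r\<bar> \<partial>\<nu>) / emeasure \<nu> (ball x r)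
           \<le> P * ennreal r *
              ((\<integral>\<^sup>+y\<in>ball x (\<Lambda> * r). g y \<partial>\<nu>) / emeasure \<nu> (ball x (\<Lambda> * r)))))"


subsection \<open>Hausdorff dimension\<close>

text \<open>Only used for \<open>s > 0\<close>; for \<open>s = 0\<close> the convention \<open>0 powr 0 = 0\<close> would not give counting
  measure.\<close>

definition hausdorff_measure :: "real \<Rightarrow> 'a::metric_space set \<Rightarrow> ennreal" where
  "hausdorff_measure s A =
     (SUP \<delta>\<in>{0<..}.
        INF U\<in>{U :: nat \<Rightarrow> 'a set. A \<subseteq> (\<Union>i. U i) \<and> (\<forall>i. bounded (U i) \<and> diameter (U i) \<le> \<delta>)}.
          \<Sum>i. ennreal (diameter (U i) powr s))"

definition hausdorff_dim :: "'a::metric_space set \<Rightarrow> ennreal" where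
  "hausdorff_dim A = Inf (ennreal ` {s. 0 < s \<and> hausdorff_measure s A = 0})"


subsection \<open>Alexandrov curvature bounded below\<close>

text \<open>The simply connected model surface of constant curvature \<open>k\<close>, with its distance: the unit
  sphere, a Euclidean plane or the hyperboloid \<open>a\<^sup>2 - b\<^sup>2 - c\<^sup>2 = 1\<close>, \<open>a > 0\<close>, the intrinsic metric
  of the first and the last being scaled by \<open>1 / sqrt \<bar>k\<bar>\<close>.\<close>

definition model_plane :: "real \<Rightarrow> (real \<times> real \<times> real) set" where
  "model_plane k =
     (if k > 0 then {(a, b, c). a\<^sup>2 + b\<^sup>2 + c\<^sup>2 = 1}
      else if k = 0 then {(a, b, c). a = 0}
      else {(a, b, c). a\<^sup>2 - b\<^sup>2 - c\<^sup>2 = 1 \<and> a > 0})"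

fun model_dist :: "real \<Rightarrow> real \<times> real \<times> real \<Rightarrow> real \<times> real \<times> real \<Rightarrow> real" where
  "model_dist k (a, b, c) (a', b', c') =
     (if k > 0 then arccos (a * a' + b * b' + c * c') / sqrt k
      else if k = 0 then sqrt ((a - a')\<^sup>2 + (b - b')\<^sup>2 + (c - c')\<^sup>2)
      else arcosh (a * a' - b * b' - c * c') / sqrt (- k))"

text \<open>\<open>\<gamma>\<close> is a shortest path from \<open>x\<close> to \<open>y\<close>, parametrized by arclength.\<close>

definition geodesic :: "(real \<Rightarrow> 'a::metric_space) \<Rightarrow> 'a \<Rightarrow> 'a \<Rightarrow> bool" where
  "geodesic \<gamma> x y \<longleftrightarrow> \<gamma> 0 = x \<and> \<gamma> (dist x y) = y \<and>
     (\<forall>s\<in>{0..dist x y}. \<forall>t\<in>{0..dist x y}. dist (\<gamma> s) (\<gamma> t) = \<bar>s - t\<bar>)"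

text \<open>
  Every geodesic triangle \<open>abc\<close> in \<open>U\<close> is at least as thick as its comparison triangle
  \<open>a'b'c'\<close> in the model surface: if \<open>d\<close> lies on the side \<open>ac\<close> and \<open>d'\<close> is the corresponding point
  on \<open>a'c'\<close>, then \<open>\<bar>bd\<bar> \<ge> \<bar>b'd'\<bar>\<close>. For \<open>k > 0\<close> the perimeter is required to be less than
  \<open>2 * pi / sqrt k\<close>, so that the comparison triangle exists and \<open>d'\<close> is determined by it.
\<close>

definition triangle_comparison :: "real \<Rightarrow> 'a::metric_space set \<Rightarrow> bool" where
  "triangle_comparison k U \<longleftrightarrow>
     (\<forall>a b c \<alpha> \<beta> \<gamma> s a' b' c' d'.
        geodesic \<alpha> a b \<longrightarrow> geodesic \<beta> b c \<longrightarrow> geodesic \<gamma> a c \<longrightarrow>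
        \<alpha> ` {0..dist a b} \<subseteq> U \<longrightarrow> \<beta> ` {0..dist b c} \<subseteq> U \<longrightarrow> \<gamma> ` {0..dist a c} \<subseteq> U \<longrightarrow>
        (k > 0 \<longrightarrow> dist a b + dist b c + dist a c < 2 * pi / sqrt k) \<longrightarrow>
        s \<in> {0..dist a c} \<longrightarrow>
        {a', b', c', d'} \<subseteq> model_plane k \<longrightarrow>
        model_dist k a' b' = dist a b \<longrightarrow> model_dist k b' c' = dist b c \<longrightarrow>
        model_dist k a' c' = dist a c \<longrightarrow>
        model_dist k a' d' = s \<longrightarrow> model_dist k d' c' = dist a c - s \<longrightarrow>
        dist b (\<gamma> s) \<ge> model_dist k b' d')"

text \<open>Curvature \<open>\<ge> k\<close> is a local condition; it is meant for length spaces.\<close>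

definition alexandrov_curvature_ge :: "real \<Rightarrow> 'a::metric_space set \<Rightarrow> bool" where
  "alexandrov_curvature_ge k X \<longleftrightarrow>
     (\<forall>x\<in>X. \<exists>U. open U \<and> x \<in> U \<and> triangle_comparison k (U \<inter> X))"

end

theory Submission
  imports Defs
begin

text \<open>
  The heart of the theorem is the right derivative of \<open>Q\<^sub>t f(x)\<close> in \<open>t\<close>, and it is obtained at
  every point \<open>x\<close> by a squeeze. From below, the semigroup law reduces the difference quotient at
  time \<open>t\<close> to one at time \<open>0\<close> for \<open>g = Q\<^sub>t f\<close>: for small \<open>s\<close> only competitors near \<open>x\<close> matter in
  \<open>Q\<^sub>s g(x)\<close>, there \<open>g\<close> descends at most with a slope \<open>a\<close> slightly larger than
  \<open>\<bar>\<nabla>\<^sup>-g\<bar>(x)\<close>, and \<open>- a r + r\<^sup>2 / 2s \<ge> - a\<^sup>2 s / 2\<close> (\<open>Liminf_hopf_lax_ge\<close>).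

  From above, let \<open>z\<close> minimize \<open>f(z) + d(x, z)\<^sup>2 / 2t\<close>. Keeping \<open>z\<close> as competitor at time
  \<open>t + s\<close> bounds the difference quotient by \<open>- d(x, z)\<^sup>2 / (2 t (t + s))\<close>, which tends to
  \<open>- (d(x, z) / t)\<^sup>2 / 2\<close>. It remains to find a minimizer with \<open>d(x, z) / t \<ge> \<bar>\<nabla>\<^sup>-Q\<^sub>t f\<bar>(x)\<close>,
  and the farthest one will do (\<open>subgrad_norm_le_farthest_minimizer\<close>): if \<open>Q\<^sub>t f\<close> descends from
  \<open>x\<close> towards \<open>y\<close> with slope \<open>a\<close>, then the minimizers for \<open>y\<close> lie at distance at least about
  \<open>a t\<close>, and by compactness they accumulate, as \<open>y\<close> tends to \<open>x\<close>, at a minimizer for \<open>x\<close>.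
  Minimizers thus play the role of the gradient of \<open>Q\<^sub>t f\<close>, and both statements on the limit of
  the difference quotients follow from \<open>hopf_lax_has_right_derivative\<close>.

  The length structure enters through the semigroup law, in the form of points that divide the
  distance between two given points in a given ratio up to a small error. The remaining claims
  come from estimates of the infimum.
\<close>

section \<open>Elementary properties of the operators\<close>

lemma hopf_lax_0 [simp]: "hopf_lax 0 f = f"
  by (rule bcontfun_eqI) (simp add: hopf_lax.rep_eq)

lemma bdd_below_hopf_lax:
  fixes f :: "'a::metric_space \<Rightarrow>\<^sub>C real"
  assumes "t > 0"
  shows "bdd_below (range (\<lambda>y. f y + (dist x y)\<^sup>2 / (2 * t)))"
proof (rule bdd_belowI2)
  fix y
  have "- norm f \<le> f y"
    using norm_bounded[of f y] by (simp add: abs_le_iff)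
  moreover have "0 \<le> (dist x y)\<^sup>2 / (2 * t)"
    using assms by simp
  ultimately show "- norm f \<le> f y + (dist x y)\<^sup>2 / (2 * t)"
    by linarith
qed

lemma hopf_lax_le:
  fixes f :: "'a::metric_space \<Rightarrow>\<^sub>C real"
  assumes "t > 0"
  shows "hopf_lax t f x \<le> f y + (dist x y)\<^sup>2 / (2 * t)"
  using cINF_lower[OF bdd_below_hopf_lax[OF assms, of f x], of y] assms
  by (simp add: hopf_lax.rep_eq)

lemma hopf_lax_greatest:
  fixes f :: "'a::metric_space \<Rightarrow>\<^sub>C real"
  assumes "t > 0" and "\<And>y. c \<le> f y + (dist x y)\<^sup>2 / (2 * t)"
  shows "c \<le> hopf_lax t f x"
  using assms by (simp add: hopf_lax.rep_eq cINF_greatest)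

lemma hopf_lax_le_self:
  fixes f :: "'a::metric_space \<Rightarrow>\<^sub>C real"
  assumes "t \<ge> 0"
  shows "hopf_lax t f x \<le> f x"
  using hopf_lax_le[of t f x x] assms by (cases "t = 0") auto

lemma Inf_le_hopf_lax:
  fixes f :: "'a::metric_space \<Rightarrow>\<^sub>C real"
  assumes "t \<ge> 0"
  shows "(INF y. f y) \<le> hopf_lax t f x"
proof -
  have bdd: "bdd_below (range f)"
    by (metis bounded_apply_bcontfun bounded_imp_bdd_below)
  then have le: "(INF y. f y) \<le> f y" for y
    by (simp add: cINF_lower)
  show ?thesis
  proof (cases "t = 0")
    case False
    with assms have "t > 0" by simp
    then show ?thesis
    proof (rule hopf_lax_greatest)
      show "(INF y. f y) \<le> f y + (dist x y)\<^sup>2 / (2 * t)" for y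
        using le[of y] \<open>t > 0\<close> by (smt (verit) divide_nonneg_pos zero_le_power2)
    qed
  qed (simp add: le)
qed

lemma hopf_lax_antimono:
  fixes f :: "'a::metric_space \<Rightarrow>\<^sub>C real"
  assumes "0 \<le> s" "s \<le> t"
  shows "hopf_lax t f x \<le> hopf_lax s f x"
proof (cases "s = 0")
  case True
  then show ?thesis using assms hopf_lax_le_self by auto
next
  case False
  with assms have "s > 0" by simp
  then show ?thesis
  proof (rule hopf_lax_greatest)
    fix y
    have "(dist x y)\<^sup>2 / (2 * t) \<le> (dist x y)\<^sup>2 / (2 * s)"
      using \<open>s > 0\<close> assms by (intro divide_left_mono) auto
    then show "hopf_lax t f x \<le> f y + (dist x y)\<^sup>2 / (2 * s)"
      using hopf_lax_le[of t f x y] \<open>s > 0\<close> assms by linarith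
  qed
qed

text \<open>The competitors \<open>d(x, z)\<^sup>2 / 2t\<close> of the infimum are Lipschitz in \<open>x\<close> with a constant
  \<open>D / t\<close>, where \<open>D\<close> bounds the distances in the space, and this passes to the infimum.\<close>

lemma hopf_lax_lipschitz:
  fixes f :: "'a::metric_space \<Rightarrow>\<^sub>C real"
  assumes "bounded (UNIV :: 'a set)" and "t > 0"
  shows "\<exists>L. L-lipschitz_on UNIV (hopf_lax t f)"
proof -
  from assms(1) obtain D where D: "dist x y \<le> D" for x y :: 'a
    by (metis bounded_two_points UNIV_I)
  have est: "hopf_lax t f x - D / t * dist x y \<le> hopf_lax t f y" for x y
    using \<open>t > 0\<close>
  proof (rule hopf_lax_greatest)
    fix z
    have "dist x z \<le> dist x y + dist y z"
      by (rule dist_triangle)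
    then have "(dist x z)\<^sup>2 - (dist y z)\<^sup>2 \<le> 2 * D * dist x y"
    proof -
      have "(dist x z)\<^sup>2 - (dist y z)\<^sup>2 = (dist x z - dist y z) * (dist x z + dist y z)"
        by (simp add: power2_eq_square algebra_simps)
      also have "\<dots> \<le> dist x y * (dist x z + dist y z)"
        using \<open>dist x z \<le> dist x y + dist y z\<close> by (intro mult_right_mono) auto
      also have "\<dots> \<le> dist x y * (2 * D)"
        using D[of x z] D[of y z] by (intro mult_left_mono) auto
      finally show ?thesis by (simp add: algebra_simps)
    qed
    then have "((dist x z)\<^sup>2 - (dist y z)\<^sup>2) / (2 * t) \<le> 2 * D * dist x y / (2 * t)"
      using \<open>t > 0\<close> by (intro divide_right_mono) auto
    then have "(dist x z)\<^sup>2 / (2 * t) - (dist y z)\<^sup>2 / (2 * t) \<le> D / t * dist x y"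
      by (simp add: diff_divide_distrib)
    then show "hopf_lax t f x - D / t * dist x y \<le> f z + (dist y z)\<^sup>2 / (2 * t)"
      using hopf_lax_le[OF \<open>t > 0\<close>, of f x z] by linarith
  qed
  have "0 \<le> D" using D[of undefined undefined] by simp
  have "(D / t)-lipschitz_on UNIV (hopf_lax t f)"
  proof (rule lipschitz_onI)
    fix x y
    show "dist (hopf_lax t f x) (hopf_lax t f y) \<le> D / t * dist x y"
      using est[of x y] est[of y x] by (simp add: dist_real_def abs_le_iff dist_commute)
  qed (use \<open>0 \<le> D\<close> \<open>t > 0\<close> in simp)
  then show ?thesis ..
qed

section \<open>Short times\<close>

lemma square_completion:
  fixes a r s :: real
  assumes "s > 0"
  shows "- (a\<^sup>2 * s / 2) \<le> - a * r + r\<^sup>2 / (2 * s)"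
proof -
  have "0 \<le> (r - a * s)\<^sup>2 / (2 * s)" using assms by simp
  also have "\<dots> = - a * r + r\<^sup>2 / (2 * s) + a\<^sup>2 * s / 2"
    using assms by (simp add: power2_eq_square field_simps)
  finally show ?thesis by linarith
qed

text \<open>For small times only competitors near the base point matter: those at distance at least
  \<open>\<delta>\<close> pay at least \<open>\<delta>\<^sup>2 / 2s\<close>, which exceeds the oscillation of \<open>f\<close>. For the others a bound on
  the descent of \<open>f\<close> near the point is enough. The constant \<open>e\<close> absorbs a merely continuous
  descent, the slope \<open>a\<close> a linear one.\<close>

lemma hopf_lax_ge_local:
  fixes f :: "'a::metric_space \<Rightarrow>\<^sub>C real"
  assumes "s > 0" and "\<delta> > 0" and "e \<ge> 0"
    and near: "\<And>y. dist x y < \<delta> \<Longrightarrow> f x - e - a * dist x y \<le> f y"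
    and small: "2 * norm f * (2 * s) \<le> \<delta>\<^sup>2"
  shows "f x - e - a\<^sup>2 * s / 2 \<le> hopf_lax s f x"
  using \<open>s > 0\<close>
proof (rule hopf_lax_greatest)
  fix y
  show "f x - e - a\<^sup>2 * s / 2 \<le> f y + (dist x y)\<^sup>2 / (2 * s)"
  proof (cases "dist x y < \<delta>")
    case True
    then show ?thesis
      using near[of y] square_completion[OF \<open>s > 0\<close>, of a "dist x y"] by simp
  next
    case False
    then have "\<delta>\<^sup>2 \<le> (dist x y)\<^sup>2"
      using \<open>\<delta> > 0\<close> by (intro power_mono) auto
    then have "2 * norm f * (2 * s) \<le> (dist x y)\<^sup>2"
      using small by linarith
    then have "2 * norm f \<le> (dist x y)\<^sup>2 / (2 * s)"
      using \<open>s > 0\<close> by (simp add: field_simps)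
    moreover have "f x - f y \<le> 2 * norm f"
      using norm_bounded[of f x] norm_bounded[of f y] by (simp add: abs_le_iff)
    moreover have "0 \<le> a\<^sup>2 * s / 2" using \<open>s > 0\<close> by simp
    ultimately show ?thesis using \<open>e \<ge> 0\<close> by linarith
  qed
qed

lemma eventually_time_small:
  fixes c \<delta> :: real
  assumes "\<delta> > 0"
  shows "\<forall>\<^sub>F s in at_right 0. 0 < s \<and> c * (2 * s) \<le> \<delta>\<^sup>2"
proof -
  have "((\<lambda>s. c * (2 * s)) \<longlongrightarrow> c * (2 * 0)) (at_right 0)"
    by (intro tendsto_intros)
  then have "\<forall>\<^sub>F s in at_right 0. c * (2 * s) < \<delta>\<^sup>2"
    using assms by (intro order_tendstoD(2)) auto
  moreover have "\<forall>\<^sub>F s in at_right 0. (0::real) < s"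
    by (simp add: eventually_at_right_less)
  ultimately show ?thesis
    by eventually_elim auto
qed

lemma hopf_lax_tendsto:
  fixes f :: "'a::metric_space \<Rightarrow>\<^sub>C real"
  assumes "compact (UNIV :: 'a set)"
  shows "((\<lambda>t. hopf_lax t f) \<longlongrightarrow> f) (at_right 0)"
proof (rule tendstoI)
  fix e :: real assume "e > 0"
  have "uniformly_continuous_on UNIV f"
    using assms by (intro compact_uniformly_continuous continuous_on_apply_bcontfun)
  then obtain \<delta> where "\<delta> > 0"
    and \<delta>: "\<And>x y. dist x y < \<delta> \<Longrightarrow> dist (f x) (f y) < e / 2"
    using \<open>e > 0\<close> unfolding uniformly_continuous_on_def
    by (metis UNIV_I half_gt_zero)
  have near: "f x - e / 2 - 0 * dist x y \<le> f y" if "dist x y < \<delta>" for x y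
    using \<delta>[OF that] unfolding dist_real_def by linarith
  from eventually_time_small[OF \<open>\<delta> > 0\<close>, of "2 * norm f"]
  show "\<forall>\<^sub>F t in at_right 0. dist (hopf_lax t f) f < e"
  proof eventually_elim
    case (elim t)
    have "dist (hopf_lax t f x) (f x) \<le> e / 2" for x
    proof -
      have "f x - e / 2 \<le> hopf_lax t f x"
        using hopf_lax_ge_local[OF _ \<open>\<delta> > 0\<close> _ near, of t x] elim \<open>e > 0\<close> by simp
      moreover have "hopf_lax t f x \<le> f x"
        using elim by (intro hopf_lax_le_self) auto
      ultimately show ?thesis by (simp add: dist_real_def)
    qed
    then have "dist (hopf_lax t f) f \<le> e / 2"
      by (rule dist_bound)
    then show ?case using \<open>e > 0\<close> by linarith
  qed
qed

section \<open>The semigroup law\<close>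

text \<open>A curve of length less than \<open>d(x, y) + e\<close> passes, by the intermediate value theorem, through
  a point at any prescribed distance from \<open>x\<close> up to \<open>d(x, y)\<close>; the rest of the curve bounds the
  distance from there to \<open>y\<close>.\<close>

lemma length_space_intermediate_point:
  fixes x y :: "'a::metric_space"
  assumes "length_space (UNIV :: 'a set)" and "0 \<le> r" "r \<le> dist x y" and "e > 0"
  shows "\<exists>z. dist x z = r \<and> dist z y \<le> dist x y - r + e"
proof -
  have "(INF \<gamma> \<in> {\<gamma>. path \<gamma> \<and> path_image \<gamma> \<subseteq> UNIV \<and> pathstart \<gamma> = x \<and> pathfinish \<gamma> = y}.
      curve_length \<gamma> 0 1) < ennreal (dist x y + e)"
  proof -
    have "ennreal (dist x y) < ennreal (dist x y + e)"
      using \<open>e > 0\<close> by (simp add: ennreal_less_iff)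
    then show ?thesis
      using assms(1) unfolding length_space_def by (metis (no_types, lifting) UNIV_I)
  qed
  then obtain \<gamma> where \<gamma>: "path \<gamma>" "\<gamma> 0 = x" "\<gamma> 1 = y"
    and len: "curve_length \<gamma> 0 1 < ennreal (dist x y + e)"
    by (auto simp: INF_less_iff pathstart_def pathfinish_def)
  have "continuous_on {0..1} (\<lambda>u. dist x (\<gamma> u))"
    using \<gamma>(1) unfolding path_def by (intro continuous_intros)
  then obtain u where u: "0 \<le> u" "u \<le> 1" "dist x (\<gamma> u) = r"
    using IVT'[of "\<lambda>u. dist x (\<gamma> u)" 0 r 1] \<gamma> assms(2,3) by auto
  define \<tau> :: "nat \<Rightarrow> real" where "\<tau> = (\<lambda>i. if i = 0 then 0 else if i = 1 then u else 1)"
  have "mono_on {..2::nat} \<tau>" "\<tau> ` {..2} \<subseteq> {0..1}"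
    using u by (auto simp: mono_on_def \<tau>_def)
  then have "(\<Sum>i<2. ennreal (dist (\<gamma> (\<tau> i)) (\<gamma> (\<tau> (Suc i))))) \<le> curve_length \<gamma> 0 1"
    unfolding curve_length_def by (intro SUP_upper2[of "(2, \<tau>)"]) auto
  moreover have "(\<Sum>i<2. ennreal (dist (\<gamma> (\<tau> i)) (\<gamma> (\<tau> (Suc i)))))
      = ennreal (dist x (\<gamma> u) + dist (\<gamma> u) y)"
    using \<gamma> by (simp add: numeral_2_eq_2 \<tau>_def ennreal_plus)
  ultimately have "ennreal (dist x (\<gamma> u) + dist (\<gamma> u) y) < ennreal (dist x y + e)"
    using len by (metis order_le_less_trans)
  then have "dist x (\<gamma> u) + dist (\<gamma> u) y < dist x y + e"
    by (subst (asm) ennreal_less_iff) auto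
  then show ?thesis using u by (intro exI[of _ "\<gamma> u"]) auto
qed

lemma quadratic_cost_superadditive:
  fixes p q s t :: real
  assumes "s > 0" "t > 0"
  shows "(p + q)\<^sup>2 / (2 * (t + s)) \<le> p\<^sup>2 / (2 * t) + q\<^sup>2 / (2 * s)"
proof -
  have "0 \<le> (p * s - q * t)\<^sup>2 / (2 * s * t * (t + s))" using assms by simp
  also have "\<dots> = p\<^sup>2 / (2 * t) + q\<^sup>2 / (2 * s) - (p + q)\<^sup>2 / (2 * (t + s))"
    using assms by (simp add: divide_simps) (simp add: power2_eq_square algebra_simps)
  finally show ?thesis by linarith
qed

text \<open>One inequality is the triangle inequality with convexity of the square. Equality in the
  convexity estimate requires a point that divides \<open>xz\<close> in the ratio \<open>t : s\<close>; a length space has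
  such points up to an arbitrarily small error.\<close>

lemma hopf_lax_semigroup:
  fixes f :: "'a::metric_space \<Rightarrow>\<^sub>C real"
  assumes ls: "length_space (UNIV :: 'a set)" and "s \<ge> 0" "t \<ge> 0"
  shows "hopf_lax t (hopf_lax s f) = hopf_lax (t + s) f"
proof (cases "s = 0 \<or> t = 0")
  case False
  with assms have st: "s > 0" "t > 0" "t + s > 0" by auto
  show ?thesis
  proof (rule bcontfun_eqI, rule antisym)
    fix x
    show "hopf_lax t (hopf_lax s f) x \<le> hopf_lax (t + s) f x"
      using st(3)
    proof (rule hopf_lax_greatest)
      fix z
      define D where "D = dist x z"
      define r where "r = t / (t + s) * D"
      have r: "0 \<le> r" "r \<le> D"
        using st by (auto simp: r_def D_def field_simps)
      have le: "hopf_lax t (hopf_lax s f) x \<le> f z + (D - r + e)\<^sup>2 / (2 * s) + r\<^sup>2 / (2 * t)"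
        if e: "e > 0" for e
      proof -
        obtain y where y: "dist x y = r" "dist y z \<le> D - r + e"
          using length_space_intermediate_point[OF ls r(1) r(2)[unfolded D_def] e] by (auto simp: D_def)
        have "hopf_lax t (hopf_lax s f) x \<le> hopf_lax s f y + r\<^sup>2 / (2 * t)"
          using hopf_lax_le[OF st(2), of "hopf_lax s f" x y] y by simp
        also have "hopf_lax s f y \<le> f z + (dist y z)\<^sup>2 / (2 * s)"
          by (rule hopf_lax_le[OF st(1)])
        also have "(dist y z)\<^sup>2 / (2 * s) \<le> (D - r + e)\<^sup>2 / (2 * s)"
          using y st by (intro divide_right_mono power_mono) auto
        finally show ?thesis by simp
      qed
      have "((\<lambda>e. f z + (D - r + e)\<^sup>2 / (2 * s) + r\<^sup>2 / (2 * t))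
          \<longlongrightarrow> f z + (D - r + 0)\<^sup>2 / (2 * s) + r\<^sup>2 / (2 * t)) (at_right 0)"
        using st by (intro tendsto_intros) auto
      then have "hopf_lax t (hopf_lax s f) x \<le> f z + (D - r + 0)\<^sup>2 / (2 * s) + r\<^sup>2 / (2 * t)"
        by (rule tendsto_lowerbound)
           (auto intro!: eventually_mono[OF eventually_at_right_less] le)
      also have "\<dots> = f z + D\<^sup>2 / (2 * (t + s))"
      proof -
        have "D - r = s / (t + s) * D"
          using st by (simp add: r_def field_simps)
        then have "(D - r)\<^sup>2 / (2 * s) + r\<^sup>2 / (2 * t)
            = (s + t) * D\<^sup>2 / (2 * (t + s)\<^sup>2)"
          using st by (simp add: r_def power_mult_distrib power_divide)
            (simp add: divide_simps, simp add: power2_eq_square algebra_simps)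
        also have "\<dots> = D\<^sup>2 / (2 * (t + s))"
          using st by (simp add: power2_eq_square add.commute)
        finally show ?thesis by simp
      qed
      finally show "hopf_lax t (hopf_lax s f) x \<le> f z + (dist x z)\<^sup>2 / (2 * (t + s))"
        by (simp add: D_def)
    qed
    show "hopf_lax (t + s) f x \<le> hopf_lax t (hopf_lax s f) x"
      using st(2)
    proof (rule hopf_lax_greatest)
      fix y
      have "hopf_lax (t + s) f x - (dist x y)\<^sup>2 / (2 * t) \<le> hopf_lax s f y"
        using st(1)
      proof (rule hopf_lax_greatest)
        fix z
        have "hopf_lax (t + s) f x \<le> f z + (dist x z)\<^sup>2 / (2 * (t + s))"
          by (rule hopf_lax_le[OF st(3)])
        also have "(dist x z)\<^sup>2 / (2 * (t + s)) \<le> (dist x y + dist y z)\<^sup>2 / (2 * (t + s))"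
          using st by (intro divide_right_mono power_mono dist_triangle) auto
        also have "\<dots> \<le> (dist x y)\<^sup>2 / (2 * t) + (dist y z)\<^sup>2 / (2 * s)"
          using st by (intro quadratic_cost_superadditive)
        finally show "hopf_lax (t + s) f x - (dist x y)\<^sup>2 / (2 * t)
            \<le> f z + (dist y z)\<^sup>2 / (2 * s)"
          by simp
      qed
      then show "hopf_lax (t + s) f x \<le> hopf_lax s f y + (dist x y)\<^sup>2 / (2 * t)"
        by simp
    qed
  qed
qed auto

section \<open>Lower bounds for the time derivative\<close>

text \<open>Every Lipschitz constant \<open>L\<close> gives the bound \<open>L\<^sup>2 / 2\<close>. The bound is turned into one from
  below for \<open>L\<close> itself, which passes to the infimum over all \<open>L\<close>, and is squared afterwards.\<close>

lemma hopf_lax_time_lipschitz: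
  fixes g :: "'a::metric_space \<Rightarrow>\<^sub>C real"
  assumes "s > 0"
  shows "ennreal (\<bar>hopf_lax s g x - g x\<bar> / s) \<le> (lip_norm g)\<^sup>2 / 2"
proof -
  define c where "c = \<bar>hopf_lax s g x - g x\<bar> / s"
  have "c \<ge> 0" using assms by (simp add: c_def)
  have "sqrt (2 * c) \<le> L" if L: "L-lipschitz_on UNIV g" for L
  proof (rule real_le_lsqrt)
    show "0 \<le> L" using L by (rule lipschitz_on_nonneg)
    have "g x - L\<^sup>2 * s / 2 \<le> hopf_lax s g x"
      using assms
    proof (rule hopf_lax_greatest)
      fix y
      have "g x - g y \<le> L * dist x y"
        using lipschitz_onD[OF L, of x y] by (simp add: dist_real_def)
      then show "g x - L\<^sup>2 * s / 2 \<le> g y + (dist x y)\<^sup>2 / (2 * s)"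
        using square_completion[OF assms, of L "dist x y"] by simp
    qed
    moreover have "hopf_lax s g x \<le> g x"
      using assms by (intro hopf_lax_le_self) auto
    ultimately have "\<bar>hopf_lax s g x - g x\<bar> \<le> L\<^sup>2 / 2 * s" by simp
    then show "2 * c \<le> L\<^sup>2" using assms by (simp add: c_def field_simps)
  qed
  then have "ennreal (sqrt (2 * c)) \<le> lip_norm g"
    unfolding lip_norm_def by (auto intro!: Inf_greatest ennreal_leI)
  then have "(ennreal (sqrt (2 * c)))\<^sup>2 / 2 \<le> (lip_norm g)\<^sup>2 / 2"
    by (intro divide_right_mono_ennreal power_mono) auto
  moreover have "(ennreal (sqrt (2 * c)))\<^sup>2 / 2 = ennreal c"
    using \<open>c \<ge> 0\<close> by (simp add: ennreal_power divide_ennreal flip: ennreal_numeral)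
  ultimately show ?thesis by (simp add: c_def)
qed

lemma eventually_descent_bound:
  fixes g :: "'a::metric_space \<Rightarrow> real"
  assumes "subgrad_norm g x < ennreal a"
  shows "\<exists>\<delta>>0. \<forall>y. dist x y < \<delta> \<longrightarrow> g x - a * dist x y \<le> g y"
proof -
  have "\<forall>\<^sub>F y in at x. ennreal (max (g x - g y) 0 / dist x y) < ennreal a"
    using assms unfolding subgrad_norm_def by (rule Limsup_lessD)
  then obtain \<delta> where "\<delta> > 0" and \<delta>: "\<And>y. y \<noteq> x \<Longrightarrow> dist y x < \<delta> \<Longrightarrow>
      ennreal (max (g x - g y) 0 / dist x y) < ennreal a"
    unfolding eventually_at by blast
  have "g x - a * dist x y \<le> g y" if "dist x y < \<delta>" for y
  proof (cases "y = x")
    case False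
    then have "max (g x - g y) 0 / dist x y < a"
      using \<delta>[of y] that by (simp add: dist_commute ennreal_less_iff)
    then have "max (g x - g y) 0 < a * dist x y"
      using False by (simp add: field_simps)
    then show ?thesis by linarith
  qed simp
  with \<open>\<delta> > 0\<close> show ?thesis by blast
qed

text \<open>If \<open>a\<close> exceeds the subgradient norm, then \<open>g\<close> descends from \<open>g(x)\<close> at most with slope \<open>a\<close>
  near \<open>x\<close>, so that \<open>Q\<^sub>s g(x) \<ge> g(x) - a\<^sup>2 s / 2\<close> for small \<open>s\<close>; then \<open>a\<close> decreases to the
  subgradient norm.\<close>

lemma Liminf_hopf_lax_ge:
  fixes g :: "'a::metric_space \<Rightarrow>\<^sub>C real"
  shows "- enn2ereal ((subgrad_norm g x)\<^sup>2 / 2)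
    \<le> Liminf (at_right 0) (\<lambda>s. ereal ((hopf_lax s g x - g x) / s))" (is "_ \<le> ?L")
proof (cases "subgrad_norm g x" rule: ennreal_cases)
  case top
  then show ?thesis
    by (simp add: ennreal_top_divide top_ennreal.rep_eq top_ereal_def)
next
  case (real b)
  have step: "ereal (- (a\<^sup>2 / 2)) \<le> ?L" if "b < a" for a
  proof -
    have "subgrad_norm g x < ennreal a"
      using that real by (simp add: ennreal_less_iff)
    from eventually_descent_bound[OF this] obtain \<delta> where "\<delta> > 0"
      and \<delta>: "\<And>y. dist x y < \<delta> \<Longrightarrow> g x - 0 - a * dist x y \<le> g y"
      by auto
    from eventually_time_small[OF \<open>\<delta> > 0\<close>, of "2 * norm g"]
    have "\<forall>\<^sub>F s in at_right 0. ereal (- (a\<^sup>2 / 2)) \<le> ereal ((hopf_lax s g x - g x) / s)"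
    proof eventually_elim
      case (elim s)
      then have "g x - 0 - a\<^sup>2 * s / 2 \<le> hopf_lax s g x"
        using hopf_lax_ge_local[OF _ \<open>\<delta> > 0\<close> _ \<delta>, of s] by simp
      then show ?case using elim by (simp add: field_simps)
    qed
    then show ?thesis by (rule Liminf_bounded)
  qed
  have "((\<lambda>a. ereal (- (a\<^sup>2 / 2))) \<longlongrightarrow> ereal (- (b\<^sup>2 / 2))) (at_right b)"
    by (intro tendsto_intros) auto
  then have "ereal (- (b\<^sup>2 / 2)) \<le> ?L"
    by (rule tendsto_upperbound)
       (auto intro!: eventually_mono[OF eventually_at_right_less] step)
  moreover have "enn2ereal ((subgrad_norm g x)\<^sup>2 / 2) = ereal (b\<^sup>2 / 2)"
    using real by (simp add: ennreal_power divide_ennreal enn2ereal_ennreal flip: ennreal_numeral)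
  ultimately show ?thesis by simp
qed

lemma Liminf_hopf_lax_semigroup_ge:
  fixes f :: "'a::metric_space \<Rightarrow>\<^sub>C real"
  assumes "length_space (UNIV :: 'a set)" and "t \<ge> 0"
  shows "- enn2ereal ((subgrad_norm (hopf_lax t f) x)\<^sup>2 / 2)
    \<le> Liminf (at_right 0) (\<lambda>s. ereal ((hopf_lax (t + s) f x - hopf_lax t f x) / s))"
proof -
  have "\<forall>\<^sub>F s in at_right 0. ereal ((hopf_lax s (hopf_lax t f) x - hopf_lax t f x) / s)
      = ereal ((hopf_lax (t + s) f x - hopf_lax t f x) / s)"
    using eventually_at_right_less[of "0::real"]
    by eventually_elim (simp add: hopf_lax_semigroup assms add.commute)
  from Liminf_eq[OF this] show ?thesis
    using Liminf_hopf_lax_ge[of "hopf_lax t f" x] by simp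
qed

section \<open>The right derivative in time\<close>

lemma hopf_lax_attained:
  fixes f :: "'a::metric_space \<Rightarrow>\<^sub>C real"
  assumes "compact (UNIV :: 'a set)" and "t > 0"
  shows "\<exists>z. f z + (dist x z)\<^sup>2 / (2 * t) \<le> hopf_lax t f x"
proof -
  have "continuous_on UNIV (\<lambda>z. f z + (dist x z)\<^sup>2 / (2 * t))"
    using \<open>t > 0\<close> by (intro continuous_intros continuous_on_apply_bcontfun) auto
  from continuous_attains_inf[OF assms(1) _ this] obtain z
    where "\<And>y. f z + (dist x z)\<^sup>2 / (2 * t) \<le> f y + (dist x y)\<^sup>2 / (2 * t)"
    by auto
  then show ?thesis using hopf_lax_greatest[OF \<open>t > 0\<close>] by blast
qed

text \<open>If \<open>z\<close> is a minimizer for \<open>y\<close>, then using it as competitor for \<open>x\<close> gives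
  \<open>Q\<^sub>t f(x) - Q\<^sub>t f(y) \<le> d(x, y) (d(x, y) + 2 d(y, z)) / 2t\<close>. A steep descent of \<open>Q\<^sub>t f\<close> towards
  points \<open>y\<close> near \<open>x\<close> thus forces minimizers far away from these \<open>y\<close>. The pairs \<open>(y, z)\<close> with this
  property form a compact set, whose projection therefore contains \<open>x\<close>.\<close>

lemma far_minimizer_of_steep_descent:
  fixes f :: "'a::metric_space \<Rightarrow>\<^sub>C real"
  assumes comp: "compact (UNIV :: 'a set)" and "t > 0"
    and steep: "ennreal a < subgrad_norm (hopf_lax t f) x" and "a \<ge> 0"
  shows "\<exists>z. f z + (dist x z)\<^sup>2 / (2 * t) \<le> hopf_lax t f x \<and> a * t \<le> dist x z"
proof -
  define S where "S = {(y, z). f z + (dist y z)\<^sup>2 / (2 * t) \<le> hopf_lax t f y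
    \<and> 2 * a * t \<le> dist x y + 2 * dist y z}"
  have "closed S"
    unfolding S_def case_prod_beta using \<open>t > 0\<close>
    by (intro closed_Collect_conj closed_Collect_le continuous_intros
        continuous_on_compose2[OF continuous_on_apply_bcontfun[of UNIV]]) auto
  moreover have "compact (UNIV :: ('a \<times> 'a) set)"
    using compact_Times[OF comp comp] by simp
  ultimately have "compact S"
    using compact_Int_closed by fastforce
  then have cl: "closed (fst ` S)"
    by (intro compact_imp_closed compact_continuous_image continuous_intros)
  have in_S: "y \<in> fst ` S"
    if y: "y \<noteq> x" "ennreal a < ennreal (max (hopf_lax t f x - hopf_lax t f y) 0 / dist x y)" for y
  proof -
    obtain z where z: "f z + (dist y z)\<^sup>2 / (2 * t) \<le> hopf_lax t f y"
      using hopf_lax_attained[OF comp \<open>t > 0\<close>] by blast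
    have "a < max (hopf_lax t f x - hopf_lax t f y) 0 / dist x y"
      using y \<open>a \<ge> 0\<close> by (simp add: ennreal_less_iff)
    then have "a * dist x y < max (hopf_lax t f x - hopf_lax t f y) 0"
      using y by (simp add: field_simps)
    moreover have "0 \<le> a * dist x y" using \<open>a \<ge> 0\<close> by simp
    ultimately have "a * dist x y < hopf_lax t f x - hopf_lax t f y"
      by linarith
    also have "\<dots> \<le> (dist x z)\<^sup>2 / (2 * t) - (dist y z)\<^sup>2 / (2 * t)"
      using z hopf_lax_le[OF \<open>t > 0\<close>, of f x z] by linarith
    also have "\<dots> \<le> (dist x y + dist y z)\<^sup>2 / (2 * t) - (dist y z)\<^sup>2 / (2 * t)"
      using \<open>t > 0\<close> by (intro diff_right_mono divide_right_mono power_mono dist_triangle) auto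
    also have "\<dots> = dist x y * ((dist x y + 2 * dist y z) / (2 * t))"
      using \<open>t > 0\<close> by (simp add: field_simps power2_eq_square)
    finally have "dist x y * a < dist x y * ((dist x y + 2 * dist y z) / (2 * t))"
      by (simp add: mult.commute)
    then have "a < (dist x y + 2 * dist y z) / (2 * t)"
      by (rule mult_left_less_imp_less) simp
    then have "2 * a * t \<le> dist x y + 2 * dist y z"
      using \<open>t > 0\<close> by (simp add: field_simps)
    with z have "(y, z) \<in> S" by (simp add: S_def)
    then show ?thesis by force
  qed
  have "x \<in> fst ` S"
  proof (rule ccontr)
    assume "x \<notin> fst ` S"
    then have "\<forall>\<^sub>F y in at x. y \<in> - fst ` S"
      using cl by (intro eventually_at_in_open') auto
    moreover have "\<forall>\<^sub>F y in at x. y \<noteq> x"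
      by (rule eventually_neq_at_within)
    ultimately have "\<forall>\<^sub>F y in at x.
        ennreal (max (hopf_lax t f x - hopf_lax t f y) 0 / dist x y) \<le> ennreal a"
      by eventually_elim (use in_S not_le in auto)
    then have "subgrad_norm (hopf_lax t f) x \<le> ennreal a"
      unfolding subgrad_norm_def by (rule Limsup_bounded)
    with steep show False by simp
  qed
  then show ?thesis by (auto simp: S_def)
qed

text \<open>The farthest minimizer dominates the subgradient norm: a slope strictly between
  \<open>d(x, z) / t\<close> and the subgradient norm would give a minimizer farther away.\<close>

lemma subgrad_norm_le_farthest_minimizer:
  fixes f :: "'a::metric_space \<Rightarrow>\<^sub>C real"
  assumes comp: "compact (UNIV :: 'a set)" and "t > 0"
  shows "\<exists>z. f z + (dist x z)\<^sup>2 / (2 * t) \<le> hopf_lax t f x \<and>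
    subgrad_norm (hopf_lax t f) x \<le> ennreal (dist x z / t)"
proof -
  define M where "M = {z. f z + (dist x z)\<^sup>2 / (2 * t) \<le> hopf_lax t f x}"
  have "closed M"
    unfolding M_def using \<open>t > 0\<close>
    by (intro closed_Collect_le continuous_intros continuous_on_apply_bcontfun) auto
  then have "compact M"
    using comp compact_Int_closed by fastforce
  moreover have "M \<noteq> {}"
    using hopf_lax_attained[OF comp \<open>t > 0\<close>] by (auto simp: M_def)
  moreover have "continuous_on M (dist x)"
    by (intro continuous_intros)
  ultimately obtain z where "z \<in> M" and far: "\<And>w. w \<in> M \<Longrightarrow> dist x w \<le> dist x z"
    using continuous_attains_sup[of M "dist x"] by blast
  have "subgrad_norm (hopf_lax t f) x \<le> ennreal (dist x z / t)"
  proof (rule ccontr)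
    assume "\<not> ?thesis"
    then obtain b where b: "ennreal (dist x z / t) < b" "b < subgrad_norm (hopf_lax t f) x"
      using dense not_le by metis
    then obtain a where a: "b = ennreal a" "a \<ge> 0"
      by (metis ennreal_cases less_top_ennreal order_less_le_trans top_greatest less_irrefl)
    with b obtain w where "w \<in> M" "a * t \<le> dist x w"
      using far_minimizer_of_steep_descent[OF comp \<open>t > 0\<close>, of a f x] by (auto simp: M_def)
    moreover have "dist x z < a * t"
      using b(1) a \<open>t > 0\<close> by (simp add: ennreal_less_iff field_simps)
    ultimately show False using far[of w] by linarith
  qed
  with \<open>z \<in> M\<close> show ?thesis by (auto simp: M_def)
qed

lemma Limsup_hopf_lax_le:
  fixes f :: "'a::metric_space \<Rightarrow>\<^sub>C real"
  assumes comp: "compact (UNIV :: 'a set)" and "t > 0"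
  shows "Limsup (at_right 0) (\<lambda>s. ereal ((hopf_lax (t + s) f x - hopf_lax t f x) / s))
    \<le> - enn2ereal ((subgrad_norm (hopf_lax t f) x)\<^sup>2 / 2)"
proof -
  obtain z where z: "f z + (dist x z)\<^sup>2 / (2 * t) \<le> hopf_lax t f x"
    and sub: "subgrad_norm (hopf_lax t f) x \<le> ennreal (dist x z / t)"
    using subgrad_norm_le_farthest_minimizer[OF assms] by blast
  define d where "d = dist x z"
  have quot: "(hopf_lax (t + s) f x - hopf_lax t f x) / s \<le> - (d\<^sup>2 / (2 * t * (t + s)))"
    if "s > 0" for s
  proof -
    have "hopf_lax (t + s) f x - hopf_lax t f x \<le> d\<^sup>2 / (2 * (t + s)) - d\<^sup>2 / (2 * t)"
      using z hopf_lax_le[of "t + s" f x z] \<open>t > 0\<close> that by (simp add: d_def)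
    also have "\<dots> = - (d\<^sup>2 / (2 * t * (t + s))) * s"
      using \<open>t > 0\<close> that by (simp add: divide_simps) (simp add: algebra_simps)
    finally show ?thesis using that by (simp add: divide_le_eq)
  qed
  have lim: "((\<lambda>s. ereal (- (d\<^sup>2 / (2 * t * (t + s))))) \<longlongrightarrow> ereal (- (d\<^sup>2 / (2 * t * (t + 0)))))
      (at_right 0)"
    using \<open>t > 0\<close> by (intro tendsto_intros) auto
  have "Limsup (at_right 0) (\<lambda>s. ereal ((hopf_lax (t + s) f x - hopf_lax t f x) / s))
      \<le> Limsup (at_right 0) (\<lambda>s. ereal (- (d\<^sup>2 / (2 * t * (t + s)))))"
  proof (rule Limsup_mono)
    show "\<forall>\<^sub>F s in at_right 0. ereal ((hopf_lax (t + s) f x - hopf_lax t f x) / s)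
        \<le> ereal (- (d\<^sup>2 / (2 * t * (t + s))))"
      using eventually_at_right_less[of "0::real"]
      by eventually_elim (use quot in \<open>simp del: uminus_ereal.simps\<close>)
  qed
  also have "\<dots> = ereal (- (d\<^sup>2 / (2 * t * (t + 0))))"
    using lim by (intro lim_imp_Limsup) auto
  also have "\<dots> = - enn2ereal ((ennreal (d / t))\<^sup>2 / 2)"
  proof -
    have "(ennreal (d / t))\<^sup>2 / 2 = ennreal ((d / t)\<^sup>2 / 2)"
      using \<open>t > 0\<close> by (simp add: d_def ennreal_power divide_ennreal flip: ennreal_numeral)
    also have "(d / t)\<^sup>2 / 2 = d\<^sup>2 / (2 * t * (t + 0))"
      by (simp add: power_divide power2_eq_square)
    finally show ?thesis
      using \<open>t > 0\<close> by (simp add: enn2ereal_ennreal)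
  qed
  also have "\<dots> \<le> - enn2ereal ((subgrad_norm (hopf_lax t f) x)\<^sup>2 / 2)"
  proof -
    have "(subgrad_norm (hopf_lax t f) x)\<^sup>2 / 2 \<le> (ennreal (d / t))\<^sup>2 / 2"
      using sub by (auto simp: d_def intro!: divide_right_mono_ennreal power_mono)
    then show ?thesis
      by (simp add: less_eq_ennreal.rep_eq)
  qed
  finally show ?thesis .
qed

lemma hopf_lax_has_right_derivative:
  fixes f :: "'a::metric_space \<Rightarrow>\<^sub>C real"
  assumes "compact (UNIV :: 'a set)" and "length_space (UNIV :: 'a set)" and "t > 0"
  shows "((\<lambda>s. ereal ((hopf_lax (t + s) f x - hopf_lax t f x) / s))
    \<longlongrightarrow> - enn2ereal ((subgrad_norm (hopf_lax t f) x)\<^sup>2 / 2)) (at_right 0)"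
proof (rule Liminf_eq_Limsup)
  note lower = Liminf_hopf_lax_semigroup_ge[OF assms(2) less_imp_le[OF assms(3)], of f x]
  note upper = Limsup_hopf_lax_le[OF assms(1,3), of f x]
  note le = Liminf_le_Limsup[OF trivial_limit_at_right_real, of 0
      "\<lambda>s. ereal ((hopf_lax (t + s) f x - hopf_lax t f x) / s)"]
  show "Liminf (at_right 0) (\<lambda>s. ereal ((hopf_lax (t + s) f x - hopf_lax t f x) / s))
      = - enn2ereal ((subgrad_norm (hopf_lax t f) x)\<^sup>2 / 2)"
    using lower le upper by (meson antisym order_trans)
  show "Limsup (at_right 0) (\<lambda>s. ereal ((hopf_lax (t + s) f x - hopf_lax t f x) / s))
      = - enn2ereal ((subgrad_norm (hopf_lax t f) x)\<^sup>2 / 2)"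
    using lower le upper by (meson antisym order_trans)
qed simp

theorem theorem2p5:
  fixes \<nu> :: "'a::metric_space measure" and f :: "'a \<Rightarrow>\<^sub>C real"
  assumes "compact (UNIV :: 'a set)"
    and "length_space (UNIV :: 'a set)"
    and "prob_space \<nu>"
    and "sets \<nu> = sets (borel :: 'a measure)"
  shows
    "(\<forall>s\<ge>0. \<forall>t\<ge>0. hopf_lax t (hopf_lax s f) = hopf_lax (t + s) f) \<and>
     (\<forall>x. \<forall>t\<ge>0. (INF y. f y) \<le> hopf_lax t f x \<and> hopf_lax t f x \<le> f x) \<and>
     (\<forall>t>0. \<exists>L. L-lipschitz_on UNIV (hopf_lax t f)) \<and>
     ((\<forall>x. (\<forall>s t. 0 \<le> s \<longrightarrow> s \<le> t \<longrightarrow> hopf_lax t f x \<le> hopf_lax s f x) \<and>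
           ((\<lambda>t. hopf_lax t f x) \<longlongrightarrow> f x) (at_right 0)) \<and>
      ((\<lambda>t. hopf_lax t f) \<longlongrightarrow> f) (at_right 0)) \<and>
     (\<forall>t\<ge>0. \<forall>s>0. \<forall>x.
        ennreal (\<bar>hopf_lax (t + s) f x - hopf_lax t f x\<bar> / s) \<le> (lip_norm (hopf_lax t f))\<^sup>2 / 2) \<and>
     (\<forall>x. \<forall>t\<ge>0.
        Liminf (at_right 0) (\<lambda>s. ereal ((hopf_lax (t + s) f x - hopf_lax t f x) / s))
          \<ge> - enn2ereal ((subgrad_norm (hopf_lax t f) x)\<^sup>2 / 2)) \<and>
     (doubling \<nu> \<and> local_poincare \<nu> \<longrightarrow>
        (\<forall>t>0. AE x in \<nu>.
           ((\<lambda>s. ereal ((hopf_lax (t + s) f x - hopf_lax t f x) / s))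
              \<longlongrightarrow> - enn2ereal ((subgrad_norm (hopf_lax t f) x)\<^sup>2 / 2)) (at_right 0))) \<and>
     (hausdorff_dim (UNIV :: 'a set) < \<infinity> \<and> (\<exists>k. alexandrov_curvature_ge k (UNIV :: 'a set)) \<longrightarrow>
        (\<forall>t>0. \<forall>x.
           ((\<lambda>s. ereal ((hopf_lax (t + s) f x - hopf_lax t f x) / s))
              \<longlongrightarrow> - enn2ereal ((subgrad_norm (hopf_lax t f) x)\<^sup>2 / 2)) (at_right 0)))"
proof (intro conjI allI impI)
  note comp = assms(1) and ls = assms(2)
  show "hopf_lax t (hopf_lax s f) = hopf_lax (t + s) f" if "0 \<le> s" "0 \<le> t" for s t
    using that by (rule hopf_lax_semigroup[OF ls])
  show "(INF y. f y) \<le> hopf_lax t f x" "hopf_lax t f x \<le> f x" if "0 \<le> t" for x t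
    using that by (simp_all only: Inf_le_hopf_lax hopf_lax_le_self)
  show "\<exists>L. L-lipschitz_on UNIV (hopf_lax t f)" if "0 < t" for t
    using compact_imp_bounded[OF comp] that by (rule hopf_lax_lipschitz)
  show "hopf_lax t f x \<le> hopf_lax s f x" if "0 \<le> s" "s \<le> t" for x s t
    using that by (rule hopf_lax_antimono)
  show "((\<lambda>t. hopf_lax t f x) \<longlongrightarrow> f x) (at_right 0)" for x
  proof (rule metric_tendsto_imp_tendsto[OF hopf_lax_tendsto[OF comp, of f]])
    show "\<forall>\<^sub>F t in at_right 0. dist (hopf_lax t f x) (f x) \<le> dist (hopf_lax t f) f"
      by (intro always_eventually allI dist_bounded)
  qed
  show "((\<lambda>t. hopf_lax t f) \<longlongrightarrow> f) (at_right 0)"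
    using comp by (rule hopf_lax_tendsto)
  show "ennreal (\<bar>hopf_lax (t + s) f x - hopf_lax t f x\<bar> / s) \<le> (lip_norm (hopf_lax t f))\<^sup>2 / 2"
    if "0 \<le> t" "0 < s" for t s x
    using hopf_lax_time_lipschitz[OF that(2), of "hopf_lax t f" x] that
    by (simp add: hopf_lax_semigroup[OF ls] add.commute)
  show "- enn2ereal ((subgrad_norm (hopf_lax t f) x)\<^sup>2 / 2)
      \<le> Liminf (at_right 0) (\<lambda>s. ereal ((hopf_lax (t + s) f x - hopf_lax t f x) / s))"
    if "0 \<le> t" for x t
    using ls that by (rule Liminf_hopf_lax_semigroup_ge)
  show "AE x in \<nu>. ((\<lambda>s. ereal ((hopf_lax (t + s) f x - hopf_lax t f x) / s))
      \<longlongrightarrow> - enn2ereal ((subgrad_norm (hopf_lax t f) x)\<^sup>2 / 2)) (at_right 0)"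
    if "0 < t" for t
    using comp ls that by (intro AE_I2 hopf_lax_has_right_derivative)
  show "((\<lambda>s. ereal ((hopf_lax (t + s) f x - hopf_lax t f x) / s))
      \<longlongrightarrow> - enn2ereal ((subgrad_norm (hopf_lax t f) x)\<^sup>2 / 2)) (at_right 0)"
    if "0 < t" for t x
    using comp ls that by (rule hopf_lax_has_right_derivative)
qed

end
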